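(* Let $G$ be a topological group, $\mathbb{K}\in\{\mathbb{R},\mathbb{C}\}$ and $d$ a positive integer. Let $W:G\times G\to\mathcal{M}_d(\mathbb{K})$ be a partial cotranslation whose projector of the units space and its complement are uniformly bounded, i.e. there exists $M\geq1$ such that $$\sup_{g\in G}\left\{\|W(g,e)\|,\|\mathrm{Id}-W(g,e)\|\right\}<M.$$ Then $W$ is boundedly conjugated to a partial cotranslation whose projector of the units space is constant and orthogonal.
   Context: $e$ is the unit of $G$; $\mathbb{K}^d$ carries the Euclidean norm, and $\|\cdot\|$ on $\mathcal{M}_d(\mathbb{K})$ is the induced operator norm. A function $W:G\times G\to\mathcal{M}_d(\mathbb{K})$ is a partial cotranslation if $W(g,kh)=W(hg,k)W(g,h)$ for all $g,h,k\in G$. For such $W$, the rank of $W(g,h)$ does not depend on $(g,h)$; this common value is denoted $\operatorname{rank}W$. The projector of the units space of $W$ is the map $g\mapsto W(g,e)$. It is called constant and orthogonal if $W(g,e)=\begin{pmatrix}\mathrm{Id}_{\operatorname{rank}W}&0\\0&0\end{pmatrix}$ for all $g\in G$. Two partial cotranslations $W,V$ are boundedly conjugated if there is a map $T:G\to GL_d(\mathbb{K})$ such that $T(hg)V(g,h)=W(g,h)T(g)$ for all $g,h\in G$ and $\sup_{g\in G}\{\|T(g)\|,\|T(g)^{-1}\|\}<\infty$. *)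

theory Defs
  imports "HOL-Analysis.Analysis"
begin

text \<open>
  Topological groups are types of class \<^class>\<open>topological_group_add\<close>. This class is written
  additively but is not assumed commutative (nor Hausdorff): \<open>h + g\<close> is the product \<open>hg\<close> and \<open>0\<close>
  is the unit \<open>e\<close>. The order of the summands therefore matters.
  All notions below are used with scalars in \<^typ>\<open>real\<close> or \<^typ>\<open>complex\<close>.
\<close>

type_synonym ('k, 'd) sqmatrix = "'k^'d^'d"

definition partial_cotranslation ::
    "('g::topological_group_add \<Rightarrow> 'g \<Rightarrow> ('k::real_normed_field, 'd::finite) sqmatrix) \<Rightarrow> bool" where
  "partial_cotranslation W \<longleftrightarrow> (\<forall>g h k. W g (k + h) = W (h + g) k ** W g h)"

definition rank_cotranslation ::
    "('g::topological_group_add \<Rightarrow> 'g \<Rightarrow> ('k::real_normed_field, 'd::finite) sqmatrix) \<Rightarrow> nat" where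
  "rank_cotranslation W = (THE r. \<forall>g h. rank (W g h) = r)"

definition units_projector ::
    "('g::topological_group_add \<Rightarrow> 'g \<Rightarrow> ('k::real_normed_field, 'd::finite) sqmatrix) \<Rightarrow> 'g \<Rightarrow> ('k, 'd) sqmatrix" where
  "units_projector W g = W g 0"

text \<open>
  The norm of \<^typ>\<open>'k^'d\<close> is the Euclidean one, so \<open>onorm ((*v) A)\<close> is the induced operator norm.
  The supremum is taken in the extended reals, so that it is \<open>\<infinity>\<close> for unbounded families.
\<close>

definition sup_opnorm :: "(('k::real_normed_field, 'd::finite) sqmatrix) set \<Rightarrow> ereal" where
  "sup_opnorm S = (SUP A\<in>S. ereal (onorm ((*v) A)))"

text \<open>
  The block matrix with blocks \<open>Id\<close> (of size \<open>r\<close>), \<open>0\<close>, \<open>0\<close>, \<open>0\<close>. The linear order of the index type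
  \<open>'d\<close> numbers the rows and columns, and \<open>card {..<i}\<close> is the zero-based position of the index \<open>i\<close>.
\<close>

definition block_id :: "nat \<Rightarrow> ('k::real_normed_field, 'd::{finite,linorder}) sqmatrix" where
  "block_id r = (\<chi> i j. if i = j \<and> card {..<i} < r then 1 else 0)"

definition constant_orthogonal_units_projector ::
    "('g::topological_group_add \<Rightarrow> 'g \<Rightarrow> ('k::real_normed_field, 'd::{finite,linorder}) sqmatrix) \<Rightarrow> bool" where
  "constant_orthogonal_units_projector W \<longleftrightarrow>
     (\<forall>g. units_projector W g = block_id (rank_cotranslation W))"

definition boundedly_conjugated ::
    "('g::topological_group_add \<Rightarrow> 'g \<Rightarrow> ('k::real_normed_field, 'd::finite) sqmatrix) \<Rightarrow>
     ('g \<Rightarrow> 'g \<Rightarrow> ('k, 'd) sqmatrix) \<Rightarrow> bool" where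
  "boundedly_conjugated W V \<longleftrightarrow>
     (\<exists>T :: 'g \<Rightarrow> ('k, 'd) sqmatrix.
        (\<forall>g. invertible (T g)) \<and>
        (\<forall>g h. T (h + g) ** V g h = W g h ** T g) \<and>
        sup_opnorm (range T \<union> range (\<lambda>g. matrix_inv (T g))) < \<infinity>)"

text \<open>\<^const>\<open>rank_cotranslation\<close> is well defined.\<close>

lemma rank_matrix_mult_le_right:
  fixes A :: "'k::field^'n^'m" and B :: "'k^'p^'n"
  shows "rank (A ** B) \<le> rank B"
proof -
  have "row i (A ** B) \<in> vec.span (rows B)" for i
  proof -
    have "row i (A ** B) = (\<Sum>k\<in>UNIV. (A $ i $ k) *s row k B)"
      by (simp add: vec_eq_iff row_def matrix_matrix_mult_def)
    also have "\<dots> \<in> vec.span (rows B)"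
      by (intro vec.span_sum vec.span_scale vec.span_base) (auto simp: rows_def)
    finally show ?thesis .
  qed
  then have "rows (A ** B) \<subseteq> vec.span (rows B)"
    by (auto simp: rows_def)
  then show ?thesis
    unfolding row_rank_def_gen by (rule vec.dim_mono)
qed

lemma rank_matrix_mult_le_left:
  fixes A :: "'k::field^'n^'m" and B :: "'k^'p^'n"
  shows "rank (A ** B) \<le> rank A"
proof -
  have "row i (A ** B) = transpose B *v row i A" for i
    by (simp add: vec_eq_iff row_def matrix_matrix_mult_def matrix_vector_mult_def
        transpose_def mult.commute)
  then have "rows (A ** B) = (*v) (transpose B) ` rows A"
    by (auto simp: rows_def)
  then show ?thesis
    unfolding row_rank_def_gen
    using vec.dim_image_le[OF matrix_vector_mul_linear_gen] by metis
qed

lemma rank_cotranslation_eq: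
  assumes "partial_cotranslation W"
  shows "rank_cotranslation W = rank (W g h)"
proof -
  have W: "W g (k + h) = W (h + g) k ** W g h" for g h k
    using assms by (simp add: partial_cotranslation_def)
  have le: "rank (W a b) \<le> rank (W c d)" for a b c d
  proof -
    have "rank (W a b) \<le> rank (W a (d + (c - a)))"
      using W[of a "b - (d + (c - a))" "d + (c - a)"]
      by (metis diff_add_cancel rank_matrix_mult_le_right)
    also have "\<dots> \<le> rank (W c d)"
      using W[of a d "c - a"] by (metis diff_add_cancel rank_matrix_mult_le_left)
    finally show ?thesis .
  qed
  show ?thesis
    unfolding rank_cotranslation_def by (rule the_equality) (auto intro: antisym le)
qed

end

theory Submission
  imports Defs
begin

text \<open>
  At each \<open>g\<close> the matrix \<open>W g 0\<close> is a projector \<open>P\<close>. Take as columns of \<open>T g\<close> a basis of the range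
  of \<open>P\<close> followed by a basis of its kernel; then \<open>V g h = (T (h + g))\<^sup>-\<^sup>1 W g h (T g)\<close> is a conjugate
  of \<open>W\<close> with \<open>V g 0 = (T g)\<^sup>-\<^sup>1 P (T g)\<close> a block identity. To control \<open>T g\<close> and its inverse
  uniformly, the bases are chosen by Gaussian elimination with complete pivoting, which works
  over both scalar fields: the entries are bounded by 1, and the coordinates of a vector are bounded
  by \<open>2\<^sup>d\<close> times its largest entry. The coordinates of \<open>x\<close> along the two bases are those of \<open>P x\<close> and
  \<open>x - P x\<close>, whence the bound on the inverse.
\<close>

section \<open>Bases with bounded coordinates by elimination\<close>

text \<open>Induction on the set \<open>J\<close> of coordinates that may be nonzero on
  \<open>S\<close>: each elimination step removes one pivot from \<open>J\<close> and costs a factor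
  2 in the coefficient bound. The bound is entrywise because pivoting compares entries. Its case
  \<open>m = 0\<close> contains the independence of \<open>B\<close>.\<close>

lemma pivoted_basis_exists:
  fixes S :: "('k::real_normed_field^'d::finite) set"
  assumes "vec.subspace S" and "\<And>x i. x \<in> S \<Longrightarrow> i \<notin> J \<Longrightarrow> x $ i = 0"
  shows "\<exists>B. finite B \<and> B \<subseteq> S \<and> S \<subseteq> vec.span B \<and> (\<forall>b\<in>B. \<forall>i. norm (b $ i) \<le> 1) \<and>
    (\<forall>c m. (\<forall>i. norm ((\<Sum>b\<in>B. c b *s b) $ i) \<le> m) \<longrightarrow> (\<forall>b\<in>B. norm (c b) \<le> 2 ^ card J * m))"
  using assms
proof (induction "card J" arbitrary: S J rule: less_induct)
  case less
  show ?case
  proof (cases "S \<subseteq> {0}")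
    case True
    then show ?thesis
      by (intro exI[of _ "{}"]) (auto intro: vec.span_zero)
  next
    case False
    then obtain x where x: "x \<in> S" "x \<noteq> 0" by auto
    \<comment> \<open>The pivot \<open>j\<close> is the position of an entry of maximal norm, so
      dividing by that entry gives a vector \<open>u\<close> with entries of norm at most 1 and
      entry 1 at \<open>j\<close>.\<close>
    have "finite (range (\<lambda>i. norm (x $ i)))" by simp
    then have "Max (range (\<lambda>i. norm (x $ i))) \<in> range (\<lambda>i. norm (x $ i))"
      by (rule Max_in) simp
    then obtain j where "Max (range (\<lambda>i. norm (x $ i))) = norm (x $ j)"
      by (rule imageE)
    then have j: "norm (x $ i) \<le> norm (x $ j)" for i
      using Max_ge[OF \<open>finite (range (\<lambda>i. norm (x $ i)))\<close>, of "norm (x $ i)"] by simp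
    have xj: "x $ j \<noteq> 0"
    proof
      assume "x $ j = 0"
      with j have "x $ i = 0" for i by simp
      with x(2) show False by (simp add: vec_eq_iff)
    qed
    define u where "u = inverse (x $ j) *s x"
    have uS: "u \<in> S" unfolding u_def by (rule vec.subspace_scale[OF less.prems(1) x(1)])
    have uj: "u $ j = 1" using xj by (simp add: u_def)
    have u1: "norm (u $ i) \<le> 1" for i
    proof -
      have "u $ i = x $ i / x $ j"
        unfolding u_def vector_smult_component divide_inverse by (rule mult.commute)
      then show ?thesis using j[of i] xj by (simp add: norm_divide)
    qed
    \<comment> \<open>Subtracting \<open>(y $ j) *s u\<close> moves any \<open>y\<close> of
      \<open>S\<close> into \<open>S'\<close>, so a spanning set of \<open>S'\<close> together with
      \<open>u\<close> spans \<open>S\<close>.\<close>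
    define S' where "S' = {y \<in> S. y $ j = 0}"
    have sub: "vec.subspace S'"
      using less.prems(1) unfolding vec.subspace_def S'_def by auto
    have jJ: "j \<in> J" using less.prems(2)[OF x(1)] xj by blast
    then have card: "card J = Suc (card (J - {j}))"
      by (metis card.remove finite)
    have "y $ i = 0" if "y \<in> S'" "i \<notin> J - {j}" for y i
      using that less.prems(2)[of y i] by (auto simp: S'_def)
    with less.hyps[OF _ sub, of "J - {j}"] card
    have "\<exists>B. finite B \<and> B \<subseteq> S' \<and> S' \<subseteq> vec.span B \<and> (\<forall>b\<in>B. \<forall>i. norm (b $ i) \<le> 1) \<and>
      (\<forall>c m. (\<forall>i. norm ((\<Sum>b\<in>B. c b *s b) $ i) \<le> m) \<longrightarrow>
        (\<forall>b\<in>B. norm (c b) \<le> 2 ^ card (J - {j}) * m))"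
      by simp
    then obtain B where B:
      "finite B" "B \<subseteq> S'" "S' \<subseteq> vec.span B" "\<forall>b\<in>B. \<forall>i. norm (b $ i) \<le> 1"
      "\<And>c m. (\<And>i. norm ((\<Sum>b\<in>B. c b *s b) $ i) \<le> m) \<Longrightarrow> \<forall>b\<in>B. norm (c b) \<le> 2 ^ card (J - {j}) * m"
      by blast
    have uB: "u \<notin> B" using B(2) uj by (auto simp: S'_def)
    show ?thesis
    proof (intro exI[of _ "insert u B"] conjI)
      show "finite (insert u B)" using B by simp
      show "insert u B \<subseteq> S" using B uS by (auto simp: S'_def)
      show "\<forall>b\<in>insert u B. \<forall>i. norm (b $ i) \<le> 1" using B u1 by auto
      show "S \<subseteq> vec.span (insert u B)"
      proof
        fix y assume y: "y \<in> S"
        have "y - (y $ j) *s u \<in> S'"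
          using y uS less.prems(1) by (auto simp: S'_def uj intro: vec.subspace_diff vec.subspace_scale)
        then show "y \<in> vec.span (insert u B)"
          using B(3) by (auto simp: vec.span_insert)
      qed
      show "\<forall>c m. (\<forall>i. norm ((\<Sum>b\<in>insert u B. c b *s b) $ i) \<le> m)
          \<longrightarrow> (\<forall>b\<in>insert u B. norm (c b) \<le> 2 ^ card J * m)"
      proof (intro allI impI)
        fix c :: "'k^'d \<Rightarrow> 'k" and m
        assume m: "\<forall>i. norm ((\<Sum>b\<in>insert u B. c b *s b) $ i) \<le> m"
        let ?s = "\<Sum>b\<in>B. c b *s b"
        have eq: "(\<Sum>b\<in>insert u B. c b *s b) = c u *s u + ?s"
          using B(1) uB by simp
        \<comment> \<open>All vectors of \<open>B\<close> vanish at the pivot, so the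
          \<open>j\<close>-th entry of the full combination is just \<open>c u\<close>.\<close>
        have "?s $ j = 0"
          using B(2) by (auto simp: S'_def intro!: sum.neutral)
        with m[rule_format, of j] have cu: "norm (c u) \<le> m"
          unfolding eq by (simp add: uj)
        then have m0: "0 \<le> m" using norm_ge_zero order_trans by blast
        \<comment> \<open>Removing the \<open>u\<close> term changes each entry by at most
          \<open>m\<close>. This doubling turns the factor for \<open>J - {j}\<close> into
          \<open>2 ^ card J\<close>.\<close>
        have "norm (?s $ i) \<le> 2 * m" for i
        proof -
          have "?s $ i = (\<Sum>b\<in>insert u B. c b *s b) $ i - c u * u $ i"
            unfolding eq by simp
          also have "norm \<dots> \<le> m + norm (c u * u $ i)"
            using m by (meson add_mono norm_triangle_ineq4 order_refl order_trans)
          also have "norm (c u * u $ i) \<le> m * 1"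
            unfolding norm_mult by (rule mult_mono[OF cu u1 m0 norm_ge_zero])
          finally show ?thesis by simp
        qed
        from B(5)[of c "2 * m", OF this]
        have "\<forall>b\<in>B. norm (c b) \<le> 2 ^ card J * m"
          by (simp add: card mult_ac)
        moreover have "m \<le> 2 ^ card J * m"
          using mult_right_mono[OF one_le_power[of "2::real" "card J"] m0] by simp
        ultimately show "\<forall>b\<in>insert u B. norm (c b) \<le> 2 ^ card J * m"
          using cu by auto
      qed
    qed
  qed
qed

text \<open>Entries are bounded by the Euclidean norm, and \<open>J = UNIV\<close> makes the
  constant depend on the dimension only. A vanishing combination then has zero coefficients, which
  is independence.\<close>

lemma pivoted_basis:
  fixes S :: "('k::real_normed_field^'d::finite) set"
  assumes "vec.subspace S"
  obtains B where "finite B" "vec.independent B" "B \<subseteq> S" "S \<subseteq> vec.span B" "card B = vec.dim S"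
    "\<And>b i. b \<in> B \<Longrightarrow> norm (b $ i) \<le> 1"
    "\<And>c b. b \<in> B \<Longrightarrow> norm (c b) \<le> 2 ^ CARD('d) * norm (\<Sum>b\<in>B. c b *s b)"
proof -
  obtain B where B: "finite B" "B \<subseteq> S" "S \<subseteq> vec.span B" "\<forall>b\<in>B. \<forall>i. norm (b $ i) \<le> 1"
    and coeff: "\<And>c m. (\<And>i. norm ((\<Sum>b\<in>B. c b *s b) $ i) \<le> m) \<Longrightarrow>
      \<forall>b\<in>B. norm (c b) \<le> 2 ^ CARD('d) * m"
    using pivoted_basis_exists[OF assms, of UNIV] by auto
  have norm: "norm (c b) \<le> 2 ^ CARD('d) * norm (\<Sum>b\<in>B. c b *s b)" if "b \<in> B" for c b
    using coeff[of c] that Finite_Cartesian_Product.norm_nth_le by blast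
  have "vec.independent B"
  proof (rule vec.independent_if_scalars_zero[OF B(1)])
    fix c :: "'k^'d \<Rightarrow> 'k" and b assume "(\<Sum>b\<in>B. c b *s b) = 0" "b \<in> B"
    with norm[of b c] show "c b = 0" by simp
  qed
  with B norm that show thesis
    using vec.basis_card_eq_dim[OF B(2,3)] by blast
qed

section \<open>Block identity, rank and similarity\<close>

text \<open>The position map is strictly monotone, hence injective, with values below
  \<open>CARD('d)\<close>; by counting it is a bijection onto \<open>{..<CARD('d)}\<close>.\<close>

lemma card_position_less:
  assumes "r \<le> CARD('d::{finite,linorder})"
  shows "card {i::'d. card {..<i} < r} = r"
proof -
  have "strict_mono (\<lambda>i::'d. card {..<i})"
    by (auto intro!: strict_monoI psubset_card_mono)
  then have inj: "inj (\<lambda>i::'d. card {..<i})" by (rule strict_mono_imp_inj_on)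
  have "range (\<lambda>i::'d. card {..<i}) = {..<CARD('d)}"
    using inj by (intro card_subset_eq) (auto simp: card_image intro!: psubset_card_mono)
  moreover have "(\<lambda>i::'d. card {..<i}) ` {i. card {..<i} < r} = range (\<lambda>i::'d. card {..<i}) \<inter> {..<r}"
    by auto
  ultimately have "(\<lambda>i::'d. card {..<i}) ` {i. card {..<i} < r} = {..<r}"
    using assms by auto
  then show ?thesis
    by (metis card_image card_lessThan inj inj_on_subset subset_UNIV)
qed

text \<open>The nonzero rows are distinct standard basis vectors, one for each position below
  \<open>r\<close>.\<close>

lemma rank_block_id:
  assumes "r \<le> CARD('d::{finite,linorder})"
  shows "rank (block_id r :: ('k::real_normed_field, 'd) sqmatrix) = r"
proof -
  let ?J = "{i::'d. card {..<i} < r}" and ?e = "\<lambda>i::'d. axis i (1::'k)"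
  have row: "row i (block_id r) = (if i \<in> ?J then ?e i else 0)" for i
    by (auto simp: row_def block_id_def vec_eq_iff axis_def)
  have "rows (block_id r :: ('k, 'd) sqmatrix) \<subseteq> vec.span (?e ` ?J)"
    by (auto simp: rows_def row intro: vec.span_zero vec.span_base)
  moreover have "?e ` ?J \<subseteq> rows (block_id r)"
    unfolding rows_def using row by (force simp: image_iff)
  moreover have "vec.independent (?e ` ?J)"
    by (rule vec.independent_mono[OF independent_cart_basis]) (auto simp: cart_basis_def)
  moreover have "card (?e ` ?J) = r"
    using card_position_less[OF assms] by (subst card_image) (auto simp: inj_on_def axis_eq_axis)
  ultimately show ?thesis
    unfolding row_rank_def_gen by (metis vec.dim_unique)
qed

lemma matrix_inv:
  assumes "invertible A"
  shows "A ** matrix_inv A = mat 1" "matrix_inv A ** A = mat 1"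
  using someI_ex[OF assms[unfolded invertible_def]] by (simp_all add: matrix_inv_def)

text \<open>Each of \<open>A\<close> and \<open>B\<close> is a product with the other as a factor,
  and multiplication never increases the rank.\<close>

lemma rank_similar:
  fixes A B :: "'k::field^'n^'n"
  assumes "invertible T" "A ** T = T ** B"
  shows "rank A = rank B"
proof -
  have inv: "T ** matrix_inv T = mat 1" "matrix_inv T ** T = mat 1"
    using matrix_inv[OF assms(1)] by auto
  have A: "A = T ** (B ** matrix_inv T)"
    using assms(2) inv(1) by (metis matrix_mul_assoc matrix_mul_rid)
  have B: "B = matrix_inv T ** (A ** T)"
    unfolding assms(2) by (simp add: matrix_mul_assoc inv(2))
  have "rank A \<le> rank B"
    by (subst A) (rule order_trans[OF rank_matrix_mult_le_right rank_matrix_mult_le_left])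
  moreover have "rank B \<le> rank A"
    by (subst B) (rule order_trans[OF rank_matrix_mult_le_right rank_matrix_mult_le_left])
  ultimately show ?thesis by simp
qed

section \<open>Entrywise bounds and operator norms\<close>

lemma norm_vec_le_l1: "norm x \<le> (\<Sum>i\<in>UNIV. norm (x $ i))"
  unfolding norm_vec_def by (rule L2_set_le_sum) simp

text \<open>A crude bound through the sum of the entries of \<open>A *v x\<close>; it suffices
  because only finiteness of the final supremum matters.\<close>

lemma norm_matrix_vector_mult_le:
  fixes A :: "'k::real_normed_field^'n^'m"
  assumes "\<And>i j. norm (A $ i $ j) \<le> b"
  shows "norm (A *v x) \<le> (of_nat CARD('m) * of_nat CARD('n) * b) * norm x"
proof -
  have b: "0 \<le> b" using assms norm_ge_zero order_trans by blast
  have "norm ((A *v x) $ i) \<le> of_nat CARD('n) * (b * norm x)" for i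
    unfolding matrix_vector_mult_def vec_lambda_beta
    by (rule order_trans[OF norm_sum sum_bounded_above])
      (use b in \<open>auto simp: norm_mult intro!: mult_mono assms Finite_Cartesian_Product.norm_nth_le\<close>)
  then have "(\<Sum>i\<in>UNIV. norm ((A *v x) $ i)) \<le> of_nat CARD('m) * (of_nat CARD('n) * (b * norm x))"
    by (intro sum_bounded_above) auto
  with norm_vec_le_l1[of "A *v x"] show ?thesis by (simp add: mult_ac)
qed

text \<open>Makes \<open>onorm\<close> usable: the estimate of \<open>norm (A *v x)\<close> by
  \<open>onorm\<close> requires a bounded linear map.\<close>

lemma bounded_linear_matrix_vector_mult:
  fixes A :: "'k::real_normed_field^'n^'m"
  shows "bounded_linear ((*v) A)"
proof -
  have "norm (A $ i $ j) \<le> norm A" for i j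
    by (meson Finite_Cartesian_Product.norm_nth_le order_trans)
  then have "norm (A *v x) \<le> norm x * (of_nat CARD('m) * of_nat CARD('n) * norm A)" for x
    using norm_matrix_vector_mult_le[of A "norm A" x] by (simp add: mult.commute)
  then show ?thesis
    by (intro bounded_linear_intro)
      (auto simp: vec_eq_iff matrix_vector_mult_def sum.distrib distrib_left scaleR_sum_right)
qed

lemma norm_mult_le_if_sup_opnorm:
  fixes A :: "('k::real_normed_field, 'd::finite) sqmatrix"
  assumes "sup_opnorm S < ereal M" "A \<in> S"
  shows "norm (A *v x) \<le> M * norm x"
proof -
  have "ereal (onorm ((*v) A)) \<le> sup_opnorm S"
    unfolding sup_opnorm_def by (rule SUP_upper[OF assms(2)])
  then have "onorm ((*v) A) \<le> M"
    using assms(1) by (metis ereal_less_eq(3) less_imp_le order_trans)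
  then show ?thesis
    by (metis bounded_linear_matrix_vector_mult mult_right_mono norm_ge_zero onorm order_trans)
qed

section \<open>Straightening a single projector\<close>

text \<open>Both constants depend only on \<open>CARD('d)\<close> and \<open>M\<close>, so the
  bounds are uniform when \<open>P\<close> runs through the projectors \<open>W g 0\<close>.\<close>

lemma block_basis_of_projector:
  fixes P :: "('k::real_normed_field, 'd::{finite,linorder}) sqmatrix"
  assumes idem: "P ** P = P"
    and M: "\<And>x. norm (P *v x) \<le> M * norm x" "\<And>x. norm ((mat 1 - P) *v x) \<le> M * norm x"
  shows "\<exists>T :: ('k, 'd) sqmatrix. invertible T \<and> P ** T = T ** block_id (rank P) \<and>
    (\<forall>x. norm (T *v x) \<le> (of_nat CARD('d) * of_nat CARD('d)) * norm x) \<and>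
    (\<forall>x. norm (matrix_inv T *v x) \<le> (of_nat CARD('d) * (2 ^ CARD('d) * M)) * norm x)"
proof -
  let ?R = "range ((*v) P)" and ?K = "{x. P *v x = 0}"
  have PP: "P *v (P *v x) = P *v x" for x
    by (simp add: matrix_vector_mul_assoc idem)
  have R: "P *v x = x" if "x \<in> ?R" for x using that PP by auto
  have "vec.subspace ?R"
    by (rule vec.linear_subspace_image[OF matrix_vector_mul_linear_gen vec.subspace_UNIV])
  then obtain B1 where B1: "finite B1" "vec.independent B1" "B1 \<subseteq> ?R" "?R \<subseteq> vec.span B1"
    "card B1 = vec.dim ?R" "\<And>b i. b \<in> B1 \<Longrightarrow> norm (b $ i) \<le> 1"
    "\<And>c b. b \<in> B1 \<Longrightarrow> norm (c b) \<le> 2 ^ CARD('d) * norm (\<Sum>b\<in>B1. c b *s b)"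
    using pivoted_basis by blast
  have "vec.subspace ?K"
    by (auto simp: vec.subspace_def matrix_vector_right_distrib vector_scalar_commute)
  then obtain B2 where B2: "finite B2" "vec.independent B2" "B2 \<subseteq> ?K" "?K \<subseteq> vec.span B2"
    "card B2 = vec.dim ?K" "\<And>b i. b \<in> B2 \<Longrightarrow> norm (b $ i) \<le> 1"
    "\<And>c b. b \<in> B2 \<Longrightarrow> norm (c b) \<le> 2 ^ CARD('d) * norm (\<Sum>b\<in>B2. c b *s b)"
    using pivoted_basis by blast
  define r where "r = vec.dim ?R"
  \<comment> \<open>Range and kernel of \<open>P\<close> are complementary, so their dimensions add
    up to \<open>CARD('d)\<close> and the two bases together supply exactly the columns of a square
    matrix.\<close>
  have "z \<in> {x + y |x y. x \<in> ?R \<and> y \<in> ?K}" for z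
  proof -
    have "z = P *v z + (z - P *v z)" "P *v (z - P *v z) = 0"
      by (simp_all add: matrix_vector_mult_diff_distrib PP)
    then show ?thesis by (intro CollectI exI[of _ "P *v z"] exI[of _ "z - P *v z"]) simp
  qed
  then have "{x + y |x y. x \<in> ?R \<and> y \<in> ?K} = UNIV" by blast
  moreover have "?R \<inter> ?K = {0}"
  proof
    show "?R \<inter> ?K \<subseteq> {0}"
    proof
      fix x assume x: "x \<in> ?R \<inter> ?K"
      then have "P *v x = x" "P *v x = 0" using R[of x] by simp_all
      then show "x \<in> {0}" by simp
    qed
    show "{0} \<subseteq> ?R \<inter> ?K"
      using vec.subspace_0[OF \<open>vec.subspace ?R\<close>] by simp
  qed
  ultimately have dims: "r + vec.dim ?K = CARD('d)"
    using vec.dim_sums_Int[OF \<open>vec.subspace ?R\<close> \<open>vec.subspace ?K\<close>]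
    by (simp only: r_def vec_dim_card) (simp add: vec.dim_eq_0)
  \<comment> \<open>\<open>J\<close> is the set of positions of the ones in
    \<open>block_id r\<close>; the range basis goes into these columns and the kernel basis into the
    others.\<close>
  define J where "J = {i::'d. card {..<i} < r}"
  have J: "card J = r" unfolding J_def using dims by (intro card_position_less) simp
  then obtain f1 where f1: "bij_betw f1 J B1"
    using B1(1,5) finite_same_card_bij[of J B1] by (auto simp: r_def)
  have "card (- J) = card B2"
    using J dims B2(5) by (simp add: Compl_eq_Diff_UNIV card_Diff_subset)
  then obtain f2 where f2: "bij_betw f2 (- J) B2"
    using B2(1) finite_same_card_bij[of "- J" B2] by auto
  define f where "f j = (if j \<in> J then f1 j else f2 j)" for j
  define T :: "('k, 'd) sqmatrix" where "T = (\<chi> i j. f j $ i)"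
  have fJ: "f j \<in> B1" if "j \<in> J" for j
    using f1 that by (auto simp: f_def bij_betw_def)
  have fK: "f j \<in> B2" if "j \<notin> J" for j
    using f2 that by (auto simp: f_def bij_betw_def)
  have Pf: "P *v f j = (if j \<in> J then f j else 0)" for j
  proof (cases "j \<in> J")
    case True
    then show ?thesis using R[OF subsetD[OF B1(3) fJ]] by simp
  next
    case False
    then show ?thesis using subsetD[OF B2(3) fK] by simp
  qed
  have Tx: "T *v x = (\<Sum>j\<in>UNIV. x $ j *s f j)" for x
    by (simp add: T_def vec_eq_iff matrix_vector_mult_def mult.commute)
  have PT: "P *v (T *v x) = (\<Sum>j\<in>J. x $ j *s f j)" for x
  proof -
    have "P *v (T *v x) = (\<Sum>j\<in>UNIV. x $ j *s (P *v f j))"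
      unfolding Tx vec.linear_sum[OF matrix_vector_mul_linear_gen] vector_scalar_commute ..
    also have "\<dots> = (\<Sum>j\<in>J. x $ j *s f j)"
      by (rule sum.mono_neutral_cong_right) (auto simp: Pf)
    finally show ?thesis .
  qed
  have QT: "(mat 1 - P) *v (T *v x) = (\<Sum>j\<in>-J. x $ j *s f j)" for x
  proof -
    have "(mat 1 - P) *v (T *v x) = T *v x - P *v (T *v x)"
      by (simp add: matrix_vector_mult_diff_rdistrib)
    also have "\<dots> = (\<Sum>j\<in>-J. x $ j *s f j)"
      unfolding PT unfolding Tx by (simp add: Compl_eq_Diff_UNIV sum_diff)
    finally show ?thesis .
  qed
  \<comment> \<open>\<open>P\<close> keeps only the \<open>B1\<close> terms of \<open>T *v x\<close>
    and \<open>mat 1 - P\<close> only the \<open>B2\<close> terms. So each coordinate is controlled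
    by one pivoted basis, at the price of the factor \<open>M\<close>.\<close>
  have coord: "norm (x $ j) \<le> 2 ^ CARD('d) * (M * norm (T *v x))" for x j
  proof (cases "j \<in> J")
    case True
    \<comment> \<open>Coordinates indexed by columns become coefficients indexed by basis
      vectors.\<close>
    let ?c = "\<lambda>b. x $ inv_into J f1 b"
    have inv: "inv_into J f1 (f1 i) = i" if "i \<in> J" for i
      using f1 that by (simp add: bij_betw_def)
    have "(\<Sum>b\<in>B1. ?c b *s b) = (\<Sum>j\<in>J. x $ j *s f j)"
      by (subst sum.reindex_bij_betw[OF f1, symmetric]) (simp add: inv f_def)
    with B1(7)[OF fJ[OF True], of ?c] True
    have "norm (x $ j) \<le> 2 ^ CARD('d) * norm (P *v (T *v x))"
      by (simp add: PT inv f_def)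
    also have "\<dots> \<le> 2 ^ CARD('d) * (M * norm (T *v x))"
      by (intro mult_left_mono M) simp
    finally show ?thesis .
  next
    case False
    let ?c = "\<lambda>b. x $ inv_into (- J) f2 b"
    have inv: "inv_into (- J) f2 (f2 i) = i" if "i \<notin> J" for i
      using f2 that by (simp add: bij_betw_def)
    have "(\<Sum>b\<in>B2. ?c b *s b) = (\<Sum>j\<in>-J. x $ j *s f j)"
      by (subst sum.reindex_bij_betw[OF f2, symmetric]) (simp add: inv f_def)
    with B2(7)[OF fK[OF False], of ?c] False
    have "norm (x $ j) \<le> 2 ^ CARD('d) * norm ((mat 1 - P) *v (T *v x))"
      by (simp add: QT inv f_def)
    also have "\<dots> \<le> 2 ^ CARD('d) * (M * norm (T *v x))"
      by (intro mult_left_mono M) simp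
    finally show ?thesis .
  qed
  \<comment> \<open>The same estimate shows that \<open>T\<close> is injective, hence invertible as
    a square matrix.\<close>
  have "x = 0" if "T *v x = 0" for x
    using coord[of x] that by (simp add: vec_eq_iff)
  then have inv: "invertible T"
    unfolding invertible_left_inverse matrix_left_invertible_ker by blast
  have PTb: "P ** T = T ** block_id r"
  proof -
    have "(\<Sum>j\<in>UNIV. (block_id r *v x) $ j *s f j) = (\<Sum>j\<in>J. x $ j *s f j)" for x
    proof -
      have "(block_id r *v x) $ j = (if j \<in> J then x $ j else 0)" for j
      proof -
        have "(block_id r *v x) $ j = (\<Sum>i\<in>UNIV. if j = i then (if j \<in> J then x $ j else 0) else 0)"
          unfolding matrix_vector_mult_def block_id_def vec_lambda_beta
          by (rule sum.cong) (auto simp: J_def)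
        then show ?thesis by simp
      qed
      then show ?thesis
        by (intro sum.mono_neutral_cong_right) auto
    qed
    then have "P *v (T *v x) = T *v (block_id r *v x)" for x
      unfolding PT Tx[of "block_id r *v x"] by simp
    then show ?thesis
      by (simp add: matrix_eq matrix_vector_mul_assoc[symmetric])
  qed
  \<comment> \<open>Up to here \<open>r\<close> is the dimension of the range; similarity to
    \<open>block_id r\<close> identifies it with \<open>rank P\<close>.\<close>
  have "rank P = r"
    by (rule trans[OF rank_similar[OF inv PTb] rank_block_id]) (use dims in simp)
  moreover have "norm (T *v x) \<le> (of_nat CARD('d) * of_nat CARD('d)) * norm x" for x
  proof -
    have "norm (T $ i $ j) \<le> 1" for i j
      using fJ[of j] fK[of j] B1(6) B2(6) by (auto simp: T_def)
    then show ?thesis using norm_matrix_vector_mult_le[of T 1 x] by simp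
  qed
  moreover have "norm (matrix_inv T *v x) \<le> (of_nat CARD('d) * (2 ^ CARD('d) * M)) * norm x" for x
  proof -
    \<comment> \<open>Applying \<open>coord\<close> to the preimage of \<open>x\<close> bounds each
      coordinate of the preimage; summing them gives the factor \<open>CARD('d)\<close>.\<close>
    have "T *v (matrix_inv T *v x) = x"
      using matrix_inv[OF inv] by (simp add: matrix_vector_mul_assoc)
    then have "norm ((matrix_inv T *v x) $ j) \<le> 2 ^ CARD('d) * (M * norm x)" for j
      using coord[of "matrix_inv T *v x" j] by simp
    then have "(\<Sum>j\<in>UNIV. norm ((matrix_inv T *v x) $ j)) \<le> of_nat CARD('d) * (2 ^ CARD('d) * (M * norm x))"
      by (intro sum_bounded_above) auto
    with norm_vec_le_l1[of "matrix_inv T *v x"] show ?thesis by (simp add: mult_ac)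
  qed
  ultimately show ?thesis using inv PTb by blast
qed

section \<open>Conjugating the cotranslation\<close>

text \<open>Stated over a general real normed field, so that the real and the complex case are both
  instances.\<close>

lemma boundedly_conjugated_constant_orthogonal:
  fixes W :: "'g::topological_group_add \<Rightarrow> 'g \<Rightarrow> ('k::real_normed_field, 'd::{finite,linorder}) sqmatrix"
  assumes W: "partial_cotranslation W"
    and M: "sup_opnorm (range (units_projector W) \<union> range (\<lambda>g. mat 1 - units_projector W g)) < ereal M"
  shows "\<exists>V. partial_cotranslation V \<and> constant_orthogonal_units_projector V \<and>
    boundedly_conjugated W V"
proof -
  let ?d = "of_nat CARD('d) :: real"
  let ?r = "rank_cotranslation W"
  have mult: "W g (k + h) = W (h + g) k ** W g h" for g h k
    using W by (simp add: partial_cotranslation_def)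
  \<comment> \<open>Every \<open>W g 0\<close> has rank \<open>?r\<close>, so the same block matrix
    serves for all \<open>g\<close>; this is what makes the new projector constant.\<close>
  have "\<exists>T :: ('k, 'd) sqmatrix. invertible T \<and> W g 0 ** T = T ** block_id ?r \<and>
    (\<forall>x. norm (T *v x) \<le> (?d * ?d) * norm x) \<and>
    (\<forall>x. norm (matrix_inv T *v x) \<le> (?d * (2 ^ CARD('d) * M)) * norm x)" for g
    unfolding rank_cotranslation_eq[OF W, of g 0]
  proof (rule block_basis_of_projector)
    \<comment> \<open>The cotranslation identity with both increments equal to the unit.\<close>
    show "W g 0 ** W g 0 = W g 0" using mult[of g 0 0] by simp
    show "norm (W g 0 *v x) \<le> M * norm x" "norm ((mat 1 - W g 0) *v x) \<le> M * norm x" for x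
      by (rule norm_mult_le_if_sup_opnorm[OF M]; auto simp: units_projector_def)+
  qed
  then obtain T :: "'g \<Rightarrow> ('k, 'd) sqmatrix" where T: "\<And>g. invertible (T g)" "\<And>g. W g 0 ** T g = T g ** block_id ?r"
    "\<And>g x. norm (T g *v x) \<le> (?d * ?d) * norm x"
    "\<And>g x. norm (matrix_inv (T g) *v x) \<le> (?d * (2 ^ CARD('d) * M)) * norm x"
    by metis
  have inv: "T g ** matrix_inv (T g) = mat 1" "matrix_inv (T g) ** T g = mat 1" for g
    using matrix_inv[OF T(1)] by auto
  define V where "V g h = matrix_inv (T (h + g)) ** W g h ** T g" for g h
  have TV: "T (h + g) ** V g h = W g h ** T g" for g h
    by (simp add: V_def matrix_mul_assoc inv)
  have V: "partial_cotranslation V"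
    unfolding partial_cotranslation_def
  proof (intro allI)
    fix g h k
    \<comment> \<open>The inner factor \<open>T (h + g)\<close> meets its inverse and cancels,
      leaving the identity for \<open>W\<close> between the outer factors.\<close>
    have "V (h + g) k ** V g h = matrix_inv (T (k + (h + g))) ** W (h + g) k ** (T (h + g) ** V g h)"
      by (simp add: V_def matrix_mul_assoc)
    also have "\<dots> = V g (k + h)"
      unfolding TV by (simp add: V_def mult add.assoc matrix_mul_assoc)
    finally show "V g (k + h) = V (h + g) k ** V g h" ..
  qed
  have V0: "V g 0 = block_id ?r" for g
  proof -
    have "V g 0 = matrix_inv (T g) ** (W g 0 ** T g)" by (simp add: V_def matrix_mul_assoc)
    then show ?thesis by (simp add: T(2) matrix_mul_assoc inv)
  qed
  \<comment> \<open>The block size demanded of \<open>V\<close> is its own rank, so this must be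
    matched with the rank of \<open>W\<close>; similarity at the unit does it.\<close>
  have "rank_cotranslation V = ?r"
    using rank_similar[of "T 0" "W 0 0" "V 0 0"] T(1)[of 0] TV[of 0 0]
    by (simp add: rank_cotranslation_eq[OF V, of 0 0] rank_cotranslation_eq[OF W, of 0 0])
  then have "constant_orthogonal_units_projector V"
    by (simp add: constant_orthogonal_units_projector_def units_projector_def V0)
  moreover have "boundedly_conjugated W V"
    unfolding boundedly_conjugated_def
  proof (intro exI[of _ T] conjI allI)
    have "sup_opnorm (range T \<union> range (\<lambda>g. matrix_inv (T g)))
        \<le> ereal (max (?d * ?d) (?d * (2 ^ CARD('d) * M)))"
      unfolding sup_opnorm_def
      by (rule SUP_least) (auto simp: le_max_iff_disj intro: onorm_le[OF T(3)] onorm_le[OF T(4)])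
    then show "sup_opnorm (range T \<union> range (\<lambda>g. matrix_inv (T g))) < \<infinity>"
      by (rule le_less_trans) (simp add: max_def)
  qed (use T TV in auto)
  ultimately show ?thesis using V by blast
qed

theorem corollary5p18:
  shows "(\<forall>W :: 'g::topological_group_add \<Rightarrow> 'g \<Rightarrow> (real, 'd::{finite,linorder}) sqmatrix.
            partial_cotranslation W \<longrightarrow>
            (\<exists>M::real. M \<ge> 1 \<and>
               sup_opnorm (range (units_projector W) \<union> range (\<lambda>g. mat 1 - units_projector W g))
                 < ereal M) \<longrightarrow>
            (\<exists>V. partial_cotranslation V \<and> constant_orthogonal_units_projector V \<and>
                 boundedly_conjugated W V))
       \<and> (\<forall>W :: 'g \<Rightarrow> 'g \<Rightarrow> (complex, 'd) sqmatrix.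
            partial_cotranslation W \<longrightarrow>
            (\<exists>M::real. M \<ge> 1 \<and>
               sup_opnorm (range (units_projector W) \<union> range (\<lambda>g. mat 1 - units_projector W g))
                 < ereal M) \<longrightarrow>
            (\<exists>V. partial_cotranslation V \<and> constant_orthogonal_units_projector V \<and>
                 boundedly_conjugated W V))"
proof (intro conjI allI impI; elim exE conjE)
qed (rule boundedly_conjugated_constant_orthogonal; assumption)+

end
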